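(* Let $r\in\mathbb N$, let $f,g_i,h_i\in\mathcal A$ for $i=1,\dots,r$, and let $L'u=f^2\,Lu+f\sum_{i=1}^r g_i\,\Gamma(h_i,u)$. Let $N\in[1,\infty)$. For every $N'\in(N,\infty]$ and every $u\in\mathcal A$, pointwise on $X$, $$\begin{aligned}R'_{N'}(u)\ \ge\ & f^4R_N(u)-\frac1{N'-N}\Big(\frac{N-2}2\Gamma(f^2,u)+\sum_i fg_i\,\Gamma(h_i,u)\Big)^2\\&+\frac12\big(f^2Lf^2-\Gamma(f^2)\big)\Gamma(u)-\frac{N-2}4\Gamma(f^2,u)^2-\sum_i f^3g_i\,H_{h_i}(u,u)\\&+\frac12\sum_i fg_i\,\Gamma(h_i,f^2)\,\Gamma(u)-\sum_i f^2\,\Gamma(fg_i,u)\,\Gamma(h_i,u).\end{aligned}$$ In the particular case $r=1$, $g_1=-(N-2)$, $h_1=f$, one may also choose $N'=N$ (the term with the factor $\frac1{N'-N}$, whose bracket vanishes identically, being omitted).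
   Context: Let $X$ be a set, $\mathcal A$ an algebra of real-valued functions on $X$ and $L:\mathcal A\to\mathcal A$ a linear operator. Put $\Gamma(f,g)=\frac12[L(fg)-fLg-gLf]$ and $\Gamma(f)=\Gamma(f,f)$. $L$ is assumed to be a diffusion operator: $\Gamma(f)\ge0$ for all $f\in\mathcal A$, and for all $r$, all $f_1,\dots,f_r\in\mathcal A$ and every $C^\infty$ function $\psi:\mathbb R^r\to\mathbb R$ with $\psi(0)=0$ one has $\psi(f_1,\dots,f_r)\in\mathcal A$ and $L\psi(f_1,\dots,f_r)=\sum_i\psi_i(f_1,\dots,f_r)\,Lf_i+\sum_{i,j}\psi_{ij}(f_1,\dots,f_r)\,\Gamma(f_i,f_j)$, where $\psi_i,\psi_{ij}$ are partial derivatives. $L,\Gamma$ are extended to the algebra generated by $\mathcal A$ and the constants by $L1=0$, $\Gamma(1,f)=0$ (constant functions are allowed as coefficient functions). Define $\Gamma_2(f,g)=\frac12[L\Gamma(f,g)-\Gamma(f,Lg)-\Gamma(g,Lf)]$, $\Gamma_2(f)=\Gamma_2(f,f)$, the Hessian $H_f(g,h)=\frac12[\Gamma(g,\Gamma(f,h))+\Gamma(h,\Gamma(f,g))-\Gamma(f,\Gamma(g,h))]$, and for $N\in[1,\infty]$ (with $1/\infty=0$) the $N$-Ricci tensor $R_N(f)(x)=\inf\{\Gamma_2(\tilde f)(x)-\frac1N(L\tilde f)^2(x):\tilde f\in\mathcal A,\ \Gamma(\tilde f-f)(x)=0\}\in[-\infty,\infty)$. $\Gamma'$, $\Gamma'_2$,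 $R'_{N'}$ denote the square field operator, iterated square field operator and $N'$-Ricci tensor defined by the same formulas with $L'$ in place of $L$ (so $\Gamma'(u)=f^2\Gamma(u)$). Conventions: $\frac1{N'-N}=0$ if $N'=\infty$; $0\cdot(-\infty)=0$. *)

theory Defs
  imports "HOL-Analysis.Analysis"
begin

text \<open>
  A function on \<open>\<real>\<^sup>r\<close> is represented by a function on sequences, of which only the values on the
  carrier of \<^const>\<open>Euclidean_space\<close> \<open>r\<close> (the sequences vanishing from index \<open>r\<close> on) matter. The
  coordinates are numbered \<open>0, \<dots>, r - 1\<close>. This makes it possible to quantify over \<open>r\<close>.
\<close>

definition partial :: "nat \<Rightarrow> ((nat \<Rightarrow> real) \<Rightarrow> real) \<Rightarrow> (nat \<Rightarrow> real) \<Rightarrow> real" where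
  "partial i \<psi> x = deriv (\<lambda>t. \<psi> (x(i := t))) (x i)"

primrec cont_diff :: "nat \<Rightarrow> nat \<Rightarrow> ((nat \<Rightarrow> real) \<Rightarrow> real) \<Rightarrow> bool" where
  "cont_diff r 0 \<psi> \<longleftrightarrow> continuous_map (Euclidean_space r) euclideanreal \<psi>"
| "cont_diff r (Suc k) \<psi> \<longleftrightarrow>
     continuous_map (Euclidean_space r) euclideanreal \<psi> \<and>
     (\<forall>i<r. (\<forall>x\<in>topspace (Euclidean_space r).
                (\<lambda>t. \<psi> (x(i := t))) field_differentiable (at (x i))) \<and>
             cont_diff r k (partial i \<psi>))"

definition smooth :: "nat \<Rightarrow> ((nat \<Rightarrow> real) \<Rightarrow> real) \<Rightarrow> bool" where
  "smooth r \<psi> \<longleftrightarrow> (\<forall>k. cont_diff r k \<psi>)"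

definition tuple :: "nat \<Rightarrow> (nat \<Rightarrow> 'a \<Rightarrow> real) \<Rightarrow> 'a \<Rightarrow> nat \<Rightarrow> real" where
  "tuple r F x = (\<lambda>i. if i < r then F i x else 0)"

type_synonym 'a operator = "('a \<Rightarrow> real) \<Rightarrow> 'a \<Rightarrow> real"

definition Gam :: "'a operator \<Rightarrow> ('a \<Rightarrow> real) \<Rightarrow> ('a \<Rightarrow> real) \<Rightarrow> 'a \<Rightarrow> real" where
  "Gam L f g x = (L (\<lambda>y. f y * g y) x - f x * L g x - g x * L f x) / 2"

definition Gam2 :: "'a operator \<Rightarrow> ('a \<Rightarrow> real) \<Rightarrow> ('a \<Rightarrow> real) \<Rightarrow> 'a \<Rightarrow> real" where
  "Gam2 L f g x = (L (Gam L f g) x - Gam L f (L g) x - Gam L g (L f) x) / 2"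

definition Hess ::
  "'a operator \<Rightarrow> ('a \<Rightarrow> real) \<Rightarrow> ('a \<Rightarrow> real) \<Rightarrow> ('a \<Rightarrow> real) \<Rightarrow> 'a \<Rightarrow> real" where
  "Hess L f g h x =
     (Gam L g (Gam L f h) x + Gam L h (Gam L f g) x - Gam L f (Gam L g h) x) / 2"

text \<open>In \<^typ>\<open>ereal\<close> one has \<open>1 / \<infinity> = 0\<close>.\<close>

definition Ric ::
  "('a \<Rightarrow> real) set \<Rightarrow> 'a operator \<Rightarrow> ereal \<Rightarrow> ('a \<Rightarrow> real) \<Rightarrow> 'a \<Rightarrow> ereal" where
  "Ric A L N f x =
     (INF v \<in> {v \<in> A. Gam L (\<lambda>y. v y - f y) (\<lambda>y. v y - f y) x = 0}.
        ereal (Gam2 L v v x - real_of_ereal (1 / N) * (L v x)\<^sup>2))"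

text \<open>
  The operator is a total function, but nothing is assumed about its values outside the algebra
  \<open>A\<close>, which need not contain the constants.
\<close>

locale diffusion_operator =
  fixes A :: "('a \<Rightarrow> real) set" and L :: "'a operator"
  assumes zero_mem: "(\<lambda>x. 0) \<in> A"
    and add_mem: "\<And>f g. f \<in> A \<Longrightarrow> g \<in> A \<Longrightarrow> (\<lambda>x. f x + g x) \<in> A"
    and scale_mem: "\<And>c f. f \<in> A \<Longrightarrow> (\<lambda>x. c * f x) \<in> A"
    and mult_mem: "\<And>f g. f \<in> A \<Longrightarrow> g \<in> A \<Longrightarrow> (\<lambda>x. f x * g x) \<in> A"
    and L_mem: "\<And>f. f \<in> A \<Longrightarrow> L f \<in> A"
    and L_add: "\<And>f g. f \<in> A \<Longrightarrow> g \<in> A \<Longrightarrow> L (\<lambda>x. f x + g x) = (\<lambda>x. L f x + L g x)"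
    and L_scale: "\<And>c f. f \<in> A \<Longrightarrow> L (\<lambda>x. c * f x) = (\<lambda>x. c * L f x)"
    and Gam_nonneg: "\<And>f x. f \<in> A \<Longrightarrow> 0 \<le> Gam L f f x"
    and comp_mem: "\<And>r \<psi> F. smooth r \<psi> \<Longrightarrow> \<psi> (\<lambda>i. 0) = 0 \<Longrightarrow> (\<And>i. i < r \<Longrightarrow> F i \<in> A) \<Longrightarrow>
          (\<lambda>x. \<psi> (tuple r F x)) \<in> A"
    and chain_rule: "\<And>r \<psi> F x. smooth r \<psi> \<Longrightarrow> \<psi> (\<lambda>i. 0) = 0 \<Longrightarrow> (\<And>i. i < r \<Longrightarrow> F i \<in> A) \<Longrightarrow>
          L (\<lambda>y. \<psi> (tuple r F y)) x =
            (\<Sum>i<r. partial i \<psi> (tuple r F x) * L (F i) x) +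
            (\<Sum>i<r. \<Sum>j<r. partial j (partial i \<psi>) (tuple r F x) * Gam L (F i) (F j) x)"

text \<open>The algebra generated by \<open>A\<close> and the constant functions.\<close>

definition adjoin_const :: "('a \<Rightarrow> real) set \<Rightarrow> ('a \<Rightarrow> real) set" where
  "adjoin_const A = {(\<lambda>x. a x + c) | a c. a \<in> A}"

text \<open>
  The linear extension of \<open>L\<close> to \<^term>\<open>adjoin_const A\<close> with \<open>L 1 = 0\<close>. If \<open>u = a + c\<close> is not in
  \<open>A\<close> then \<open>A\<close> contains no nonzero constant, so \<open>a\<close> is unique. If \<open>A\<close> does contain the constants,
  the chain rule already forces \<open>L 1 = 0\<close>. The identity \<open>\<Gamma>(1, f) = 0\<close> is then automatic.
\<close>

definition extend_const :: "('a \<Rightarrow> real) set \<Rightarrow> 'a operator \<Rightarrow> 'a operator" where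
  "extend_const A L u =
     (if u \<in> A then L u else L (THE a. a \<in> A \<and> (\<exists>c. u = (\<lambda>x. a x + c))))"

end

theory Submission
  imports Defs
begin

text \<open>
  Fix a point \<open>x\<close> with \<open>f(x) \<noteq> 0\<close> (at a zero of \<open>f\<close> both sides vanish) and a competitor \<open>v\<close> in the
  infimum defining the Ricci tensor of \<open>L'\<close> at \<open>u\<close>; since \<open>\<Gamma>' = f\<^sup>2 \<Gamma>\<close> this means
  \<open>\<Gamma>(v - u)(x) = 0\<close>. Assume that \<open>R = R_N(u)(x)\<close> is finite, the bound being void otherwise.

  The product rule for \<open>\<Gamma>\<close> expresses \<open>\<Gamma>'_2(v)\<close> through \<open>L\<close> alone (\<open>Gam2_L'\<close>). With \<open>p = f\<^sup>2\<close>, all its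
  terms occur in the claim except \<open>p\<^sup>2 \<Gamma>_2(v) + 2 p H_v(p, v) - p Lv \<Gamma>(p, v)\<close>. To bound this, observe
  that \<open>R\<close> is a lower bound for \<open>\<Gamma>_2 - (L \<cdot>)\<^sup>2 / N\<close> not only at \<open>v\<close> but also at every
  \<open>v + (w - w(x)) (k - k(x))\<close>, because the product of two functions vanishing at \<open>x\<close> has no first
  order part there. The value at such a function is explicit (\<open>Gam2_add_deviation\<close>), so one obtains
  a lower bound for \<open>\<Gamma>_2(v) + 4 H_v(w, k)\<close> (\<open>le_Gam2_deviation\<close>). The choice
  \<open>w = p / (2 p(x))\<close>, \<open>k = v\<close> produces precisely \<open>2 p H_v(p, v)\<close>, and the remaining square in
  \<open>p Lv - (N - 2) \<Gamma>(p, v) / 2\<close> absorbs the change of \<open>(L'v)\<^sup>2 / N'\<close> by the convexity inequality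
  \<open>(a + b)\<^sup>2 / N' \<le> a\<^sup>2 / N + b\<^sup>2 / (N' - N)\<close>.

  This gives the claim with \<open>v\<close> in place of \<open>u\<close> on the right. The terms in \<open>\<Gamma>\<close> do not see the
  difference, by the Cauchy--Schwarz inequality. For the Hessians \<open>H_h(v, v)\<close> and \<open>H_h(u, u)\<close> this is not
  automatic: \<open>\<Gamma>(w)(x) = 0\<close> does not imply \<open>H_h(w, w)(x) = 0\<close> in general. But if \<open>R\<close> is finite, then scaling
  \<open>w\<close> in the lower bound for \<open>\<Gamma>_2(v) + 4 H_v(w, k)\<close> forces \<open>H_v(w, k)(x) = 0\<close> whenever
  \<open>\<Gamma>(w)(x) = 0\<close>, which is enough (\<open>Hess_eq_0\<close>, \<open>Hess_diag_cong\<close>).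

  The product rule for \<open>\<Gamma>\<close> follows from the chain rule for cubes of a single function by polarisation
  (\<open>L_mult3\<close>).
\<close>

section \<open>Square field calculus on an algebra with constants\<close>

text \<open>
  The coefficient functions lie in the algebra \<open>B\<close> obtained by adjoining constants, while the Ricci
  tensor is an infimum over the smaller algebra \<open>A\<close>. All that matters is that \<open>A\<close> is an ideal of \<open>B\<close>
  containing the image of \<open>L\<close>, and that \<open>\<Gamma>\<close> is a nonnegative biderivation on \<open>B\<close>. Working on \<open>B\<close>
  makes centred functions \<open>w - w(x)\<close> available.
\<close>

locale gamma_calculus =
  fixes A B :: "('a \<Rightarrow> real) set" and L :: "'a operator"
  assumes ideal_subset: "A \<subseteq> B"
    and const_mem: "\<And>c. (\<lambda>x. c) \<in> B"
    and add_mem: "\<And>f g. f \<in> B \<Longrightarrow> g \<in> B \<Longrightarrow> (\<lambda>x. f x + g x) \<in> B"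
    and mult_mem: "\<And>f g. f \<in> B \<Longrightarrow> g \<in> B \<Longrightarrow> (\<lambda>x. f x * g x) \<in> B"
    and ideal_add: "\<And>f g. f \<in> A \<Longrightarrow> g \<in> A \<Longrightarrow> (\<lambda>x. f x + g x) \<in> A"
    and ideal_mult: "\<And>f g. f \<in> B \<Longrightarrow> g \<in> A \<Longrightarrow> (\<lambda>x. f x * g x) \<in> A"
    and L_ideal: "\<And>f. f \<in> B \<Longrightarrow> L f \<in> A"
    and L_const: "\<And>c. L (\<lambda>x. c) = (\<lambda>x. 0)"
    and L_add: "\<And>f g. f \<in> B \<Longrightarrow> g \<in> B \<Longrightarrow> L (\<lambda>x. f x + g x) = (\<lambda>x. L f x + L g x)"
    and L_scale: "\<And>c f. f \<in> B \<Longrightarrow> L (\<lambda>x. c * f x) = (\<lambda>x. c * L f x)"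
    and Gam_nonneg: "\<And>f x. f \<in> B \<Longrightarrow> 0 \<le> Gam L f f x"
    and Gam_mult: "\<And>f g h x. f \<in> B \<Longrightarrow> g \<in> B \<Longrightarrow> h \<in> B \<Longrightarrow>
          Gam L (\<lambda>y. f y * g y) h x = f x * Gam L g h x + g x * Gam L f h x"
    and ideal_coset: "\<And>f. f \<in> B \<Longrightarrow> \<exists>a\<in>A. \<exists>c. f = (\<lambda>x. a x + c)"
begin

lemma ideal_mem: "f \<in> A \<Longrightarrow> f \<in> B"
  using ideal_subset by blast

lemma L_mem: "f \<in> B \<Longrightarrow> L f \<in> B"
  by (simp add: L_ideal ideal_mem)

lemma diff_mem: "f \<in> B \<Longrightarrow> g \<in> B \<Longrightarrow> (\<lambda>x. f x - g x) \<in> B"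
  using add_mem[OF _ mult_mem[OF const_mem[of "-1"]], of f g] by simp

lemma ideal_diff: "f \<in> A \<Longrightarrow> g \<in> A \<Longrightarrow> (\<lambda>x. f x - g x) \<in> A"
  using ideal_add[OF _ ideal_mult[OF const_mem[of "-1"]], of f g] by simp

lemma ideal_mult_right: "f \<in> A \<Longrightarrow> g \<in> B \<Longrightarrow> (\<lambda>x. f x * g x) \<in> A"
  using ideal_mult[of g f] by (simp add: mult.commute)

lemma power2_mem: "f \<in> B \<Longrightarrow> (\<lambda>x. (f x)\<^sup>2) \<in> B"
  by (simp add: power2_eq_square mult_mem)

lemma ideal_sum: "(\<And>i. i \<in> I \<Longrightarrow> F i \<in> A) \<Longrightarrow> A \<noteq> {} \<Longrightarrow> (\<lambda>x. \<Sum>i\<in>I. F i x) \<in> A"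
proof (induction I rule: infinite_finite_induct)
  case (insert i I)
  then show ?case by (simp add: ideal_add)
qed (use ideal_mult[OF const_mem[of 0]] in auto)

lemma Gam_comm: "Gam L f g = Gam L g f"
  by (simp add: Gam_def fun_eq_iff mult.commute)

lemma Gam_ideal: "f \<in> B \<Longrightarrow> g \<in> A \<Longrightarrow> Gam L f g \<in> A"
proof -
  assume fg: "f \<in> B" "g \<in> A"
  have "(\<lambda>y. (1/2) * ((L (\<lambda>z. f z * g z) y - f y * L g y) - g y * L f y)) \<in> A"
    by (intro ideal_mult const_mem ideal_diff L_ideal mult_mem fg ideal_mem[OF fg(2)] ideal_mult_right)
  also have "(\<lambda>y. (1/2) * ((L (\<lambda>z. f z * g z) y - f y * L g y) - g y * L f y)) = Gam L f g"
    by (simp add: Gam_def fun_eq_iff)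
  finally show ?thesis .
qed

lemma Gam_mem: "f \<in> B \<Longrightarrow> g \<in> B \<Longrightarrow> Gam L f g \<in> B"
proof -
  assume fg: "f \<in> B" "g \<in> B"
  have "(\<lambda>y. (1/2) * ((L (\<lambda>z. f z * g z) y - f y * L g y) - g y * L f y)) \<in> B"
    by (intro mult_mem const_mem diff_mem L_mem fg)
  also have "(\<lambda>y. (1/2) * ((L (\<lambda>z. f z * g z) y - f y * L g y) - g y * L f y)) = Gam L f g"
    by (simp add: Gam_def fun_eq_iff)
  finally show ?thesis .
qed

lemmas mem = const_mem add_mem diff_mem mult_mem power2_mem L_mem Gam_mem

lemma L_diff: "f \<in> B \<Longrightarrow> g \<in> B \<Longrightarrow> L (\<lambda>x. f x - g x) = (\<lambda>x. L f x - L g x)"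
  using L_add[OF _ mult_mem[OF const_mem[of "-1"]], of f g] L_scale[of g "-1"] by simp

lemma L_mult: "L (\<lambda>y. f y * g y) = (\<lambda>x. f x * L g x + g x * L f x + 2 * Gam L f g x)"
  by (simp add: Gam_def fun_eq_iff field_simps)

lemma Gam_const: "Gam L (\<lambda>y. c) f = (\<lambda>x. 0)" if "f \<in> B"
  using that by (simp add: Gam_def L_const L_scale fun_eq_iff)

lemma Gam_add: "f \<in> B \<Longrightarrow> g \<in> B \<Longrightarrow> h \<in> B \<Longrightarrow>
    Gam L (\<lambda>y. f y + g y) h x = Gam L f h x + Gam L g h x"
  by (simp add: Gam_def L_add mult_mem distrib_right distrib_left diff_divide_distrib add_divide_distrib)

lemma Gam_diff: "f \<in> B \<Longrightarrow> g \<in> B \<Longrightarrow> h \<in> B \<Longrightarrow>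
    Gam L (\<lambda>y. f y - g y) h x = Gam L f h x - Gam L g h x"
  by (simp add: Gam_def L_diff mult_mem left_diff_distrib right_diff_distrib diff_divide_distrib add_divide_distrib)

lemma Gam_power2: "f \<in> B \<Longrightarrow> h \<in> B \<Longrightarrow> Gam L (\<lambda>y. (f y)\<^sup>2) h x = 2 * f x * Gam L f h x"
  by (simp add: power2_eq_square Gam_mult)

lemma Gam_sum: "(\<And>i. i \<in> I \<Longrightarrow> F i \<in> B) \<Longrightarrow> h \<in> B \<Longrightarrow> finite I \<Longrightarrow>
    (\<lambda>y. \<Sum>i\<in>I. F i y) \<in> B \<and> Gam L (\<lambda>y. \<Sum>i\<in>I. F i y) h x = (\<Sum>i\<in>I. Gam L (F i) h x)"
  by (induction I rule: infinite_finite_induct) (simp_all add: const_mem Gam_const Gam_add add_mem)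

lemmas Gam_left = Gam_const Gam_add Gam_diff Gam_mult Gam_power2

lemma Gam_right:
  assumes "h \<in> B"
  shows "Gam L h (\<lambda>y. c) = (\<lambda>x. 0)"
    and "f \<in> B \<Longrightarrow> g \<in> B \<Longrightarrow> Gam L h (\<lambda>y. f y + g y) x = Gam L h f x + Gam L h g x"
    and "f \<in> B \<Longrightarrow> g \<in> B \<Longrightarrow> Gam L h (\<lambda>y. f y - g y) x = Gam L h f x - Gam L h g x"
    and "f \<in> B \<Longrightarrow> g \<in> B \<Longrightarrow>
      Gam L h (\<lambda>y. f y * g y) x = f x * Gam L h g x + g x * Gam L h f x"
    and "f \<in> B \<Longrightarrow> Gam L h (\<lambda>y. (f y)\<^sup>2) x = 2 * f x * Gam L h f x"
  using assms by (simp_all add: Gam_comm[of h] Gam_left)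

text \<open>
  The quadratic function \<open>t \<mapsto> \<Gamma>(k + t w)(x)\<close> is nonnegative and, as its leading coefficient vanishes,
  affine; hence it is constant.
\<close>

lemma Gam_eq_0:
  assumes "w \<in> B" "k \<in> B" and w0: "Gam L w w x = 0"
  shows "Gam L w k x = 0"
proof (rule ccontr)
  assume ne: "Gam L w k x \<noteq> 0"
  \<comment> \<open>the parameter at which the affine function takes the value \<open>-1\<close>\<close>
  define t where "t = - (Gam L k k x + 1) / (2 * Gam L w k x)"
  have "0 \<le> Gam L (\<lambda>y. k y + t * w y) (\<lambda>y. k y + t * w y) x"
    using assms by (intro Gam_nonneg mem)
  also have "\<dots> = Gam L k k x + 2 * t * Gam L w k x"
    using assms by (simp add: Gam_left Gam_right mem Gam_comm[of k w] w0)
  also have "\<dots> = -1"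
    using ne by (simp add: t_def field_simps)
  finally show False by simp
qed

section \<open>Perturbation by a product of centred functions\<close>

text \<open>
  Up to an additive constant, which neither \<open>L\<close> nor \<open>\<Gamma>\<close> sees, \<open>m\<close> is the product
  \<open>(w - w(x)) (k - k(x))\<close>. The constant is left out because the full product need not lie in \<open>A\<close>
  when \<open>w\<close> and \<open>k\<close> do.
\<close>

context
  fixes v w k m :: "'a \<Rightarrow> real" and x :: 'a
  assumes v: "v \<in> B" and w: "w \<in> B" and k: "k \<in> B"
  defines "m \<equiv> \<lambda>y. w y * k y - w x * k y - k x * w y"
begin

lemma Gam_deviation: "b \<in> B \<Longrightarrow> Gam L b m = (\<lambda>y. (w y - w x) * Gam L b k y + (k y - k x) * Gam L b w y)"
  using w k by (simp add: m_def fun_eq_iff Gam_right mem algebra_simps)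

lemma L_deviation: "L m = (\<lambda>y. (w y - w x) * L k y + (k y - k x) * L w y + 2 * Gam L w k y)"
proof -
  have "L m = (\<lambda>y. L (\<lambda>y. w y * k y) y - w x * L k y - k x * L w y)"
    using w k by (simp add: m_def L_diff L_scale mem)
  then show ?thesis
    using Gam_comm[of w k] by (simp add: L_mult fun_eq_iff algebra_simps)
qed

lemma m_mem: "m \<in> B"
  unfolding m_def by (intro mem w k)

lemma Gam_deviation': "b \<in> B \<Longrightarrow> Gam L m b = (\<lambda>y. (w y - w x) * Gam L b k y + (k y - k x) * Gam L b w y)"
  using Gam_deviation by (simp add: Gam_comm[of m])

lemma L_add_deviation: "L (\<lambda>y. v y + m y) x = L v x + 2 * Gam L w k x"
  using v m_mem by (simp add: L_add L_deviation)

text \<open>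
  At \<open>x\<close> the function \<open>m\<close> has zero gradient, and its Hessian is the symmetrised product of the
  gradients of \<open>w\<close> and \<open>k\<close>. Accordingly \<open>\<Gamma>_2\<close> of the sum has a mixed term \<open>4 H_v(w, k)\<close> and
  the squared norm of the Hessian of \<open>m\<close>.
\<close>

lemma Gam2_add_deviation:
  "Gam2 L (\<lambda>y. v y + m y) (\<lambda>y. v y + m y) x =
     Gam2 L v v x + 4 * Hess L v w k x + 2 * (Gam L w w x * Gam L k k x + (Gam L w k x)\<^sup>2)"
proof -
  note [simp] = v w k m_mem mem L_add L_diff L_const Gam_left Gam_right L_mult L_deviation
    Gam_deviation Gam_deviation'
  have "Gam L (\<lambda>y. v y + m y) (\<lambda>y. v y + m y) = 
      (\<lambda>y. Gam L v v y + 2 * Gam L v m y + Gam L m m y)"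
    by (simp add: fun_eq_iff Gam_comm[of m v] del: Gam_deviation Gam_deviation')
  then have "Gam2 L (\<lambda>y. v y + m y) (\<lambda>y. v y + m y) x = Gam2 L v v x
       + (L (Gam L v m) x - Gam L v (L m) x - Gam L m (L v) x)
       + (L (Gam L m m) x - 2 * Gam L m (L m) x) / 2"
    by (simp add: Gam2_def del: Gam_deviation Gam_deviation' L_deviation)
       (simp add: field_simps del: Gam_deviation Gam_deviation' L_deviation)
  moreover have "L (Gam L v m) x - Gam L v (L m) x - Gam L m (L v) x = 4 * Hess L v w k x"
    by (simp add: Hess_def Gam_comm)
  moreover have "L (Gam L m m) x - 2 * Gam L m (L m) x
      = 4 * (Gam L w w x * Gam L k k x + (Gam L w k x)\<^sup>2)"
    by simp (simp add: algebra_simps power2_eq_square Gam_comm)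
  ultimately show ?thesis by simp
qed

end


text \<open>
  Elements of \<open>B\<close> can be replaced by elements of \<open>A\<close> inside \<open>\<Gamma>\<close>; this keeps perturbations of
  elements of \<open>A\<close> by elements of \<open>B\<close> within the class over which the Ricci tensor is an infimum.
\<close>

lemma ideal_translate:
  assumes "f \<in> B"
  obtains a where "a \<in> A" "\<And>b. b \<in> B \<Longrightarrow> Gam L f b = Gam L a b" 
    "\<And>b. b \<in> B \<Longrightarrow> Gam L b f = Gam L b a"
proof -
  obtain a c where a: "a \<in> A" "f = (\<lambda>x. a x + c)"
    using ideal_coset[OF assms] by blast
  then have "Gam L f b = Gam L a b" if "b \<in> B" for b
    unfolding a(2) fun_eq_iff using that by (simp add: Gam_left mem ideal_mem a(1))
  then show thesis
    using that[OF a(1)] by (simp add: Gam_comm[of _ f] Gam_comm[of _ a])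
qed

section \<open>Consequences of a finite Ricci tensor\<close>

text \<open>
  The second assumption says that the real number \<open>R\<close> is a lower bound for the Ricci tensor
  at \<open>u\<close> and \<open>x\<close>, with \<open>c\<close> the reciprocal of the dimension.
\<close>

context
  fixes u :: "'a \<Rightarrow> real" and x :: 'a and R c :: real
  assumes u: "u \<in> A"
    and R_le: "\<And>v. v \<in> A \<Longrightarrow> Gam L (\<lambda>y. v y - u y) (\<lambda>y. v y - u y) x = 0 \<Longrightarrow>
      R \<le> Gam2 L v v x - c * (L v x)\<^sup>2"
begin

text \<open>
  The lower bound \<open>R\<close> improves itself: \<open>v + m\<close> belongs to the same class as \<open>v\<close>, since the gradient of
  \<open>m\<close> vanishes at \<open>x\<close>.
\<close>

lemma le_Gam2_deviation:
  assumes v: "v \<in> A" and vu: "Gam L (\<lambda>y. v y - u y) (\<lambda>y. v y - u y) x = 0"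
    and w: "w \<in> B" and k: "k \<in> B"
  shows "R \<le> Gam2 L v v x + 4 * Hess L v w k x
      + 2 * (Gam L w w x * Gam L k k x + (Gam L w k x)\<^sup>2) - c * (L v x + 2 * Gam L w k x)\<^sup>2"
proof -
  obtain w' where w': "w' \<in> A" "\<And>b. b \<in> B \<Longrightarrow> Gam L w b = Gam L w' b"
    "\<And>b. b \<in> B \<Longrightarrow> Gam L b w = Gam L b w'"
    using ideal_translate[OF w] by metis
  obtain k' where k': "k' \<in> A" "\<And>b. b \<in> B \<Longrightarrow> Gam L k b = Gam L k' b"
    "\<And>b. b \<in> B \<Longrightarrow> Gam L b k = Gam L b k'"
    using ideal_translate[OF k] by metis
  note B = ideal_mem[OF v] ideal_mem[OF u] ideal_mem[OF w'(1)] ideal_mem[OF k'(1)] w k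
  define m where "m = (\<lambda>y. w' y * k' y - w' x * k' y - k' x * w' y)"
  have m: "m \<in> A"
    unfolding m_def by (intro ideal_diff ideal_mult mem B w'(1) k'(1))
  note mB = ideal_mem[OF m]
  have m0: "Gam L m b x = 0" if "b \<in> B" for b
    using Gam_deviation'[OF B(1,3,4) that] by (simp add: m_def)
  then have m0': "Gam L b m x = 0" if "b \<in> B" for b
    using that by (simp add: Gam_comm[of b])
  have "Gam L (\<lambda>y. (v y + m y) - u y) (\<lambda>y. (v y + m y) - u y) x =
      Gam L (\<lambda>y. v y - u y) (\<lambda>y. v y - u y) x"
    using B mB m0 m0' by (simp add: Gam_left Gam_right mem)
  then have "R \<le> Gam2 L (\<lambda>y. v y + m y) (\<lambda>y. v y + m y) x - c * (L (\<lambda>y. v y + m y) x)\<^sup>2"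
    using R_le[OF ideal_add[OF v m]] vu by simp
  also have "\<dots> = Gam2 L v v x + 4 * Hess L v w' k' x
      + 2 * (Gam L w' w' x * Gam L k' k' x + (Gam L w' k' x)\<^sup>2) - c * (L v x + 2 * Gam L w' k' x)\<^sup>2"
    using Gam2_add_deviation[OF B(1,3,4)] L_add_deviation[OF B(1,3,4)] by (simp add: m_def)
  finally show ?thesis
    using w'(2,3) k'(2,3) B by (simp add: Hess_def mem)
qed

text \<open>
  If the gradient of \<open>w\<close> vanishes at \<open>x\<close>, replacing \<open>w\<close> by \<open>t w\<close> makes the right-hand side of the
  previous bound affine in \<open>t\<close> with slope \<open>4 H_v(w, k)\<close>; being bounded below, it has slope zero.
\<close>

lemma Hess_eq_0:
  assumes v: "v \<in> A" and vu: "Gam L (\<lambda>y. v y - u y) (\<lambda>y. v y - u y) x = 0"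
    and w: "w \<in> B" and w0: "Gam L w w x = 0" and k: "k \<in> B"
  shows "Hess L v w k x = 0"
proof (rule ccontr)
  assume ne: "Hess L v w k x \<noteq> 0"
  note B = ideal_mem[OF v] w k
  define D where "D = Gam2 L v v x - c * (L v x)\<^sup>2"
  \<comment> \<open>the parameter at which the affine function takes the value \<open>R - 1\<close>\<close>
  define t where "t = (R - D - 1) / (4 * Hess L v w k x)"
  have wk: "Gam L w b x = 0" "Gam L b w x = 0" if "b \<in> B" for b
    using Gam_eq_0[OF w that w0] by (simp_all add: Gam_comm[of b])
  have tw: "Gam L (\<lambda>y. t * w y) b = (\<lambda>y. t * Gam L w b y)"
      "Gam L b (\<lambda>y. t * w y) = (\<lambda>y. t * Gam L w b y)" if "b \<in> B" for b
    using that B by (simp_all add: Gam_left Gam_right mem fun_eq_iff Gam_comm[of b])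
  have "R \<le> Gam2 L v v x + 4 * Hess L v (\<lambda>y. t * w y) k x - c * (L v x)\<^sup>2"
    using le_Gam2_deviation[OF v vu mult_mem[OF const_mem[of t] w] k] B
    by (simp add: tw wk mem)
  also have "Hess L v (\<lambda>y. t * w y) k x = t * Hess L v w k x"
    using B by (simp add: Hess_def tw mem Gam_right Gam_comm[of v w]) (simp add: field_simps)
  also have "Gam2 L v v x + 4 * (t * Hess L v w k x) - c * (L v x)\<^sup>2 = R - 1"
    using ne by (simp add: t_def D_def field_simps)
  finally show False by simp
qed

text \<open>
  With \<open>w = v - u\<close>, the difference of the two sides is
  \<open>\<Gamma>(u, \<Gamma>(h, w)) - \<Gamma>(h, \<Gamma>(u, w)) - \<Gamma>(h, \<Gamma>(w)) / 2\<close>,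
  that is, \<open>- H_u(w, h) - H_v(w, h)\<close>, since \<open>\<Gamma>(w, \<cdot>)\<close> vanishes at \<open>x\<close>.
\<close>

lemma Hess_diag_cong:
  assumes v: "v \<in> A" and vu: "Gam L (\<lambda>y. v y - u y) (\<lambda>y. v y - u y) x = 0"
    and h: "h \<in> B"
  shows "Hess L h v v x = Hess L h u u x"
proof -
  define w where "w = (\<lambda>y. v y - u y)"
  note B = ideal_mem[OF u] h
  have w: "w \<in> B"
    unfolding w_def by (intro mem ideal_mem u v)
  have w0: "Gam L w w x = 0"
    using vu by (simp add: w_def)
  have v_eq: "v = (\<lambda>y. u y + w y)"
    by (simp add: w_def)
  have wk: "Gam L w b x = 0" "Gam L b w x = 0" if "b \<in> B" for b
    using Gam_eq_0[OF w that w0] by (simp_all add: Gam_comm[of b])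
  have [simp]: "Gam L v b = (\<lambda>y. Gam L u b y + Gam L w b y)"
    "Gam L b v = (\<lambda>y. Gam L u b y + Gam L w b y)" if "b \<in> B" for b
    using that B w by (simp_all add: v_eq fun_eq_iff Gam_left Gam_right Gam_comm[of b])
  have "Hess L u w h x = 0" "Hess L v w h x = 0"
    using Hess_eq_0[OF u _ w w0 h] Hess_eq_0[OF v vu w w0 h] B by (simp_all add: Gam_const mem)
  then show ?thesis
    using B w ideal_mem[OF v]
    by (simp add: Hess_def Gam_left Gam_right mem wk) (simp add: algebra_simps Gam_comm)
qed

end

section \<open>Conformal transformation, time change and drift\<close>

context
  fixes L' :: "'a operator" and f :: "'a \<Rightarrow> real" and g h :: "nat \<Rightarrow> 'a \<Rightarrow> real" and I :: "nat set"
  assumes f: "f \<in> B" and fin: "finite I"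
    and g: "\<And>i. i \<in> I \<Longrightarrow> g i \<in> B" and h: "\<And>i. i \<in> I \<Longrightarrow> h i \<in> B"
    and L': "\<And>v y. v \<in> A \<Longrightarrow> L' v y = (f y)\<^sup>2 * L v y + f y * (\<Sum>i\<in>I. g i y * Gam L (h i) v y)"
begin

lemma L'_eq: "v \<in> A \<Longrightarrow>
    L' v = (\<lambda>y. (f y)\<^sup>2 * L v y + (\<Sum>i\<in>I. (f y * g i y) * Gam L (h i) v y))"
  by (simp add: fun_eq_iff L' sum_distrib_left mult.assoc)

lemma L'_ideal: "v \<in> A \<Longrightarrow> L' v \<in> A"
  unfolding L'_eq
  by (intro ideal_add ideal_sum ideal_mult mem f g h L_ideal Gam_ideal) (auto simp: ideal_mem)

text \<open>The drift is a derivation and so does not contribute to the square field operator.\<close>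

lemma Gam_L':
  assumes "v \<in> A" "w \<in> A"
  shows "Gam L' v w = (\<lambda>y. (f y)\<^sup>2 * Gam L v w y)"
proof
  fix y
  note B = ideal_mem[OF assms(1)] ideal_mem[OF assms(2)]
  have "(\<Sum>i\<in>I. g i y * Gam L (h i) (\<lambda>z. v z * w z) y) =
      v y * (\<Sum>i\<in>I. g i y * Gam L (h i) w y) + w y * (\<Sum>i\<in>I. g i y * Gam L (h i) v y)"
    using B h by (simp add: Gam_right algebra_simps sum.distrib sum_distrib_left)
  then show "Gam L' v w y = (f y)\<^sup>2 * Gam L v w y"
    unfolding Gam_def[of L'] using assms
    by (simp add: L' ideal_mult B L_mult) (simp add: field_simps)
qed

lemma Gam2_L':
  assumes v: "v \<in> A"
  shows "Gam2 L' v v x = (f x) ^ 4 * Gam2 L v v x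
     + 1 / 2 * (f x)\<^sup>2 * L (\<lambda>y. (f y)\<^sup>2) x * Gam L v v x
     + 2 * (f x)\<^sup>2 * Hess L v (\<lambda>y. (f y)\<^sup>2) v x
     - (f x)\<^sup>2 * L v x * Gam L (\<lambda>y. (f y)\<^sup>2) v x
     - (\<Sum>i\<in>I. (f x) ^ 3 * g i x * Hess L (h i) v v x)
     + 1 / 2 * (\<Sum>i\<in>I. f x * g i x * Gam L (h i) (\<lambda>y. (f y)\<^sup>2) x) * Gam L v v x
     - (\<Sum>i\<in>I. (f x)\<^sup>2 * Gam L (\<lambda>y. f y * g i y) v x * Gam L (h i) v x)"
proof -
  define p where "p = (\<lambda>y. (f y)\<^sup>2)"
  have p: "p \<in> B"
    unfolding p_def by (intro mem f)
  note B = ideal_mem[OF v] f p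
  have "L' (Gam L' v v) x = L' (\<lambda>y. p y * Gam L v v y) x"
    using v by (simp add: Gam_L' p_def)
  also have "\<dots> = p x * (p x * L (Gam L v v) x + Gam L v v x * L p x + 2 * Gam L p (Gam L v v) x)
      + (\<Sum>i\<in>I. f x * g i x * (p x * Gam L (h i) (Gam L v v) x + Gam L v v x * Gam L (h i) p x))"
    using B h v
    by (simp add: L' p_def[THEN fun_cong, symmetric] ideal_mult Gam_ideal L_mult Gam_right mem
        sum_distrib_left mult.assoc)
  finally have 1: "L' (Gam L' v v) x = \<dots>" .
  have "Gam L v (\<lambda>y. \<Sum>i\<in>I. (f y * g i y) * Gam L (h i) v y) x =
      (\<Sum>i\<in>I. f x * g i x * Gam L v (Gam L (h i) v) x + Gam L (h i) v x * Gam L (\<lambda>y. f y * g i y) v x)"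
    using Gam_sum[of I "\<lambda>i y. (f y * g i y) * Gam L (h i) v y" v x] B g h fin
    by (simp add: mem Gam_comm[of v] Gam_left)
  moreover have "(\<lambda>y. \<Sum>i\<in>I. (f y * g i y) * Gam L (h i) v y) \<in> B"
    using Gam_sum[of I "\<lambda>i y. (f y * g i y) * Gam L (h i) v y" v x] B g h fin
    by (simp add: mem)
  ultimately have 2: "Gam L' v (L' v) x = p x * (p x * Gam L v (L v) x + L v x * Gam L p v x +
      (\<Sum>i\<in>I. f x * g i x * Gam L v (Gam L (h i) v) x + Gam L (h i) v x * Gam L (\<lambda>y. f y * g i y) v x))"
    using B v by (simp add: Gam_L' L'_ideal) (simp add: L'_eq Gam_right mem Gam_comm p_def)
  have p2: "(f x)^2 = p x" "(f x)^4 = p x * p x" "(f x)^3 = f x * p x"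
    by (simp_all add: p_def power2_eq_square eval_nat_numeral)
  have 3: "2 * Hess L v p v x = Gam L p (Gam L v v) x"
    by (simp add: Hess_def Gam_comm)
  have 4: "Hess L (h i) v v x = Gam L v (Gam L (h i) v) x - Gam L (h i) (Gam L v v) x / 2" for i
    by (simp add: Hess_def field_simps)
  have "Gam2 L' v v x = L' (Gam L' v v) x / 2 - Gam L' v (L' v) x"
    by (simp add: Gam2_def field_simps)
  also have "\<dots> = p x * p x * Gam2 L v v x + 1/2 * p x * L p x * Gam L v v x + p x * (2 * Hess L v p v x)
       - p x * L v x * Gam L p v x
      - (\<Sum>i\<in>I. f x * p x * g i x * Hess L (h i) v v x)
     + 1 / 2 * (\<Sum>i\<in>I. f x * g i x * Gam L (h i) p x) * Gam L v v x
     - (\<Sum>i\<in>I. p x * Gam L (\<lambda>y. f y * g i y) v x * Gam L (h i) v x)"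
    unfolding 1 2 3 4 Gam2_def
    by (simp add: algebra_simps sum.distrib sum_subtractf sum_distrib_left sum_divide_distrib
        add_divide_distrib diff_divide_distrib)
  finally show ?thesis
    unfolding p_def[symmetric] p2 by (simp add: mult.assoc mult.left_commute)
qed

text \<open>
  The factors \<open>\<alpha>\<close> and \<open>\<beta>\<close> stand for \<open>1 / N'\<close> and \<open>1 / (N' - N)\<close>. Requiring only the
  convexity inequality for the actual bracket \<open>b\<close> covers at once finite \<open>N'\<close>, infinite \<open>N'\<close>
  (\<open>\<alpha> = \<beta> = 0\<close>) and the borderline case \<open>N' = N\<close>, in which \<open>b = 0\<close>.
\<close>

lemma time_change_bound:
  fixes N \<alpha> \<beta> R :: real
  defines "p \<equiv> \<lambda>y. (f y)\<^sup>2"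
  assumes u: "u \<in> A" and N: "1 \<le> N" and fx: "f x \<noteq> 0"
    and R_le: "\<And>v. v \<in> A \<Longrightarrow> Gam L (\<lambda>y. v y - u y) (\<lambda>y. v y - u y) x = 0 \<Longrightarrow>
      R \<le> Gam2 L v v x - 1 / N * (L v x)\<^sup>2"
    and v: "v \<in> A" and vu: "Gam L (\<lambda>y. v y - u y) (\<lambda>y. v y - u y) x = 0"
    and b: "b = (N - 2) / 2 * Gam L p u x + (\<Sum>i\<in>I. f x * g i x * Gam L (h i) u x)"
    and ab: "\<And>a. \<alpha> * (a + b)\<^sup>2 \<le> 1 / N * a\<^sup>2 + \<beta> * b\<^sup>2"
  shows "(f x) ^ 4 * R + (- (\<beta> * b\<^sup>2)
     + 1 / 2 * (p x * L p x - Gam L p p x) * Gam L u u x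
     - (N - 2) / 4 * (Gam L p u x)\<^sup>2
     - (\<Sum>i\<in>I. (f x) ^ 3 * g i x * Hess L (h i) u u x)
     + 1 / 2 * (\<Sum>i\<in>I. f x * g i x * Gam L (h i) p x) * Gam L u u x
     - (\<Sum>i\<in>I. (f x)\<^sup>2 * Gam L (\<lambda>y. f y * g i y) u x * Gam L (h i) u x))
     \<le> Gam2 L' v v x - \<alpha> * (L' v x)\<^sup>2"
proof -
  have p: "p \<in> B"
    unfolding p_def by (intro mem f)
  note B = p ideal_mem[OF v] ideal_mem[OF u]
  have Guv: "Gam L k u x = Gam L k v x" if "k \<in> B" for k
    using Gam_eq_0[OF diff_mem[OF B(2,3)] that vu] that B
    by (simp add: Gam_left Gam_comm[of k])
  have Huv: "Hess L (h i) u u x = Hess L (h i) v v x" if "i \<in> I" for i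
    using Hess_diag_cong[OF u R_le v vu h[OF that]] by simp
  define P H G D where "P = p x" and "H = Hess L v p v x" and "G = Gam L p v x"
    and "D = (\<Sum>i\<in>I. f x * g i x * Gam L (h i) v x)"
  define S where "S = - (\<Sum>i\<in>I. (f x) ^ 3 * g i x * Hess L (h i) v v x)
     + 1 / 2 * (\<Sum>i\<in>I. f x * g i x * Gam L (h i) p x) * Gam L v v x
     - (\<Sum>i\<in>I. (f x)\<^sup>2 * Gam L (\<lambda>y. f y * g i y) v x * Gam L (h i) v x)"
  \<comment> \<open>perturbing by \<open>t p\<close> and \<open>v\<close> turns \<open>4 P\<^sup>2 H_v(t p, v)\<close> into the term \<open>2 P H\<close> of \<open>\<Gamma>'_2(v)\<close>\<close>
  define t where "t = 1 / (2 * P)"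
  define a where "a = P * L v x - (N - 2) / 2 * G"
  have P0: "P \<noteq> 0"
    using fx by (simp add: P_def p_def)
  have P2: "(f x)\<^sup>2 = P" "(f x) ^ 4 = P\<^sup>2"
    by (simp_all add: P_def p_def)
  have tp: "Gam L (\<lambda>y. t * p y) k = (\<lambda>y. t * Gam L p k y)"
      "Gam L k (\<lambda>y. t * p y) = (\<lambda>y. t * Gam L p k y)" if "k \<in> B" for k
    using that B by (simp_all add: Gam_left Gam_right mem fun_eq_iff Gam_comm[of k])
  have "Hess L v (\<lambda>y. t * p y) v x = t * H"
    using B by (simp add: H_def Hess_def tp mem Gam_right Gam_comm[of v p])
  then have "R \<le> Gam2 L v v x + 4 * t * H + 2 * t\<^sup>2 * (Gam L p p x * Gam L v v x + G\<^sup>2)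
      - 1 / N * (L v x + 2 * t * G)\<^sup>2"
    using le_Gam2_deviation[OF u R_le v vu mult_mem[OF const_mem[of t] p] B(2)] B
    by (simp add: tp mem G_def algebra_simps power2_eq_square)
  then have "P\<^sup>2 * R \<le> P\<^sup>2 * (Gam2 L v v x + 4 * t * H
      + 2 * t\<^sup>2 * (Gam L p p x * Gam L v v x + G\<^sup>2) - 1 / N * (L v x + 2 * t * G)\<^sup>2)"
    by (intro mult_left_mono) auto
  also have "\<dots> = P\<^sup>2 * Gam2 L v v x + 2 * P * H + 1 / 2 * (Gam L p p x * Gam L v v x + G\<^sup>2)
      - 1 / N * (P * L v x + G)\<^sup>2"
    using P0 N by (simp add: t_def field_simps power2_eq_square)
  finally have 1: "P\<^sup>2 * R \<le> \<dots>" .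
  \<comment> \<open>completing the square; \<open>a\<close> is chosen such that \<open>L' v x = a + b\<close>\<close>
  have 2: "1 / N * (P * L v x + G)\<^sup>2 = 1 / N * a\<^sup>2 + P * L v x * G - (N - 2) / 4 * G\<^sup>2 + 1 / 2 * G\<^sup>2"
    using N by (simp add: a_def field_simps power2_eq_square)
  have 3: "Gam2 L' v v x = P\<^sup>2 * Gam2 L v v x + 1 / 2 * P * L p x * Gam L v v x
      + 2 * P * H - P * L v x * G + S"
    unfolding Gam2_L'[OF v] p_def[symmetric] P2 S_def G_def H_def by simp
  have 4: "b = (N - 2) / 2 * G + D"
    unfolding b D_def G_def using p h by (simp add: Guv)
  have 5: "L' v x = a + b"
    unfolding L'_eq[OF v] P2 4 a_def by (simp add: D_def)
  have "P\<^sup>2 * R + (- (\<beta> * b\<^sup>2) + 1 / 2 * (P * L p x - Gam L p p x) * Gam L v v x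
      - (N - 2) / 4 * G\<^sup>2 + S) \<le> Gam2 L' v v x - \<alpha> * (L' v x)\<^sup>2"
    using 1 ab[of a] unfolding 2 3 5 distrib_left right_diff_distrib left_diff_distrib by linarith
  moreover have "Gam L u u x = Gam L v v x"
    using Guv[OF B(3)] Guv[OF B(2)] by (simp add: Gam_comm)
  moreover have "(\<Sum>i\<in>I. (f x)\<^sup>2 * Gam L (\<lambda>y. f y * g i y) u x * Gam L (h i) u x)
      = (\<Sum>i\<in>I. (f x)\<^sup>2 * Gam L (\<lambda>y. f y * g i y) v x * Gam L (h i) v x)"
    using f g h by (simp add: Guv mem)
  ultimately show ?thesis
    using p by (simp add: Guv Huv S_def G_def P2 P_def[symmetric])
qed

end

end

section \<open>The product rule for the square field operator\<close>

lemma smooth_poly: "smooth 1 (\<lambda>x. poly p (x 0))"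
  and partial_poly: "partial 0 (\<lambda>x. poly p (x 0)) = (\<lambda>x. poly (pderiv p) (x 0))"
proof -
  have partial: "partial 0 (\<lambda>x. poly p (x 0)) = (\<lambda>x. poly (pderiv p) (x 0))" for p
    by (auto simp: partial_def fun_eq_iff intro!: DERIV_imp_deriv poly_DERIV)
  have "continuous_map (Euclidean_space 1) euclideanreal (poly p \<circ> (\<lambda>x. x 0))" for p
    by (rule continuous_map_compose[where X' = euclideanreal])
      (auto simp: Euclidean_space_def intro!: continuous_map_from_subtopology
        continuous_map_product_projection continuous_intros)
  then have cont: "continuous_map (Euclidean_space 1) euclideanreal (\<lambda>x. poly p (x 0))" for p
    by (simp add: o_def)
  have "cont_diff 1 k (\<lambda>x. poly p (x 0))" for k p
  proof (induction k arbitrary: p)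
    case (Suc k)
    then show ?case
      using cont[of p] by (auto simp: partial field_differentiable_def intro!: exI poly_DERIV)
  qed (use cont in simp)
  then show "smooth 1 (\<lambda>x. poly p (x 0))" 
    by (simp add: smooth_def)
  show "partial 0 (\<lambda>x. poly p (x 0)) = (\<lambda>x. poly (pderiv p) (x 0))"
    by (rule partial)
qed

context diffusion_operator
begin

lemma diff_mem: "f \<in> A \<Longrightarrow> g \<in> A \<Longrightarrow> (\<lambda>x. f x - g x) \<in> A"
  using add_mem[OF _ scale_mem[of g "-1"], of f] by simp

lemma L_diff: "f \<in> A \<Longrightarrow> g \<in> A \<Longrightarrow> L (\<lambda>x. f x - g x) = (\<lambda>x. L f x - L g x)"
  using L_add[OF _ scale_mem[of g "-1"], of f] L_scale[of g "-1"] by simp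

lemma L_poly:
  assumes "f \<in> A" "poly p 0 = 0"
  shows "(\<lambda>x. poly p (f x)) \<in> A"
    and "L (\<lambda>y. poly p (f y)) x =
      poly (pderiv p) (f x) * L f x + poly (pderiv (pderiv p)) (f x) * Gam L f f x"
  using comp_mem[OF smooth_poly[of p], of "\<lambda>i. f"] chain_rule[OF smooth_poly[of p], of "\<lambda>i. f" x] assms
  by (simp_all add: partial_poly tuple_def)

lemma L_power3:
  assumes "f \<in> A"
  shows "(\<lambda>x. (f x) ^ 3) \<in> A"
    and "L (\<lambda>y. (f y) ^ 3) = (\<lambda>x. 3 * (f x)\<^sup>2 * L f x + 6 * f x * Gam L f f x)"
  using L_poly[OF assms, of "monom 1 3"]
  by (simp_all add: poly_monom pderiv_monom fun_eq_iff)

lemma Gam_add: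
  assumes "f \<in> A" "g \<in> A" "h \<in> A"
  shows "Gam L (\<lambda>y. f y + g y) h x = Gam L f h x + Gam L g h x"
    and "Gam L h (\<lambda>y. f y + g y) x = Gam L h f x + Gam L h g x"
  using assms by (simp_all add: Gam_def L_add mult_mem distrib_right distrib_left diff_divide_distrib
      add_divide_distrib)

text \<open>
  The chain rule for a product of three functions, obtained by polarising the one for cubes. This
  avoids verifying smoothness of a function of several variables.
\<close>

lemma L_mult3:
  assumes "f \<in> A" "g \<in> A" "h \<in> A"
  shows "L (\<lambda>y. f y * g y * h y) x =
    f x * g x * L h x + f x * h x * L g x + g x * h x * L f x
      + 2 * (f x * Gam L g h x + g x * Gam L f h x + h x * Gam L f g x)"
proof -
  note A = assms add_mem scale_mem mult_mem
  have comm: "Gam L k l = Gam L l k" for k l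
    by (simp add: Gam_def fun_eq_iff mult.commute)
  have "6 * L (\<lambda>y. f y * g y * h y) x = L (\<lambda>y. 6 * (f y * g y * h y)) x"
    using A by (simp add: L_scale)
  also have "(\<lambda>y. 6 * (f y * g y * h y)) = (\<lambda>y. ((f y + g y) + h y) ^ 3 - (f y + g y) ^ 3
      - (f y + h y) ^ 3 - (g y + h y) ^ 3 + f y ^ 3 + g y ^ 3 + h y ^ 3)"
    by (simp add: fun_eq_iff algebra_simps power3_eq_cube)
  also have "L \<dots> x = 6 * (f x * g x * L h x + f x * h x * L g x + g x * h x * L f x
      + 2 * (f x * Gam L g h x + g x * Gam L f h x + h x * Gam L f g x))"
    using A by (simp add: L_add L_diff diff_mem L_power3 Gam_add)
      (simp add: algebra_simps power2_eq_square comm[of g f] comm[of h f] comm[of h g])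
  finally show ?thesis by simp
qed

text \<open>Comparing the two ways of computing \<open>L (f g h)\<close>: as a triple product and as \<open>(f g) h\<close>.\<close>

lemma Gam_mult:
  assumes "f \<in> A" "g \<in> A" "h \<in> A"
  shows "Gam L (\<lambda>y. f y * g y) h x = f x * Gam L g h x + g x * Gam L f h x"
  using L_mult3[OF assms, of x] by (simp add: Gam_def field_simps)

text \<open>
  \<open>\<Gamma>(c\<^sup>2, c)\<close> is \<open>c \<Gamma>(c, c)\<close> by linearity and \<open>2 c \<Gamma>(c, c)\<close> by the product rule, so that
  \<open>\<Gamma>(c, c) = - c L c / 2\<close> vanishes.
\<close>

lemma L_const:
  assumes "(\<lambda>x. c) \<in> A"
  shows "L (\<lambda>x. c) = (\<lambda>x. 0)"
proof
  fix x
  have "Gam L (\<lambda>y. c * c) (\<lambda>y. c) x = c * Gam L (\<lambda>y. c) (\<lambda>y. c) x"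
    using L_scale[OF assms, of c] L_scale[OF mult_mem[OF assms assms], of c] by (simp add: Gam_def field_simps)
  with Gam_mult[OF assms assms assms, of x] L_scale[OF assms, of c] L_scale[OF assms, of 0]
  show "L (\<lambda>x. c) x = 0"
    by (cases "c = 0") (simp_all add: Gam_def fun_eq_iff)
qed

section \<open>Adjoining the constants\<close>

text \<open>
  The extension ignores additive constants. If \<open>a + c\<close> is not in \<open>A\<close>, then \<open>A\<close> contains no nonzero
  constant and the representative is unique; otherwise \<open>c\<close> is in \<open>A\<close> and is annihilated by \<open>L\<close>.
\<close>

lemma extend_const_add:
  assumes a: "a \<in> A"
  shows "extend_const A L (\<lambda>x. a x + c) = L a"
proof (cases "(\<lambda>x. a x + c) \<in> A")
  case True
  have "(\<lambda>x. c) \<in> A"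
    using diff_mem[OF True a] by simp
  then show ?thesis
    using True a by (simp add: extend_const_def L_add L_const)
next
  case False
  have "(THE b. b \<in> A \<and> (\<exists>d. (\<lambda>x. a x + c) = (\<lambda>x. b x + d))) = a"
  proof (rule the_equality)
    fix b assume "b \<in> A \<and> (\<exists>d. (\<lambda>x. a x + c) = (\<lambda>x. b x + d))"
    then obtain d where b: "b \<in> A" "\<And>x. a x + c = b x + d"
      by (auto simp: fun_eq_iff)
    have "(\<lambda>x. a x - b x) = (\<lambda>x. d - c)"
      using b(2) by (auto simp: fun_eq_iff algebra_simps)
    then have "(\<lambda>x. d - c) \<in> A"
      using diff_mem[OF a b(1)] by simp
    have "d = c"
    proof (rule ccontr)
      assume "d \<noteq> c"
      then have "(\<lambda>x. c) \<in> A"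
        using scale_mem[OF \<open>(\<lambda>x. d - c) \<in> A\<close>, of "c / (d - c)"] by simp
      then show False
        using False add_mem[OF a] by blast
    qed
    then show "b = a"
      using b(2) by (simp add: fun_eq_iff)
  qed (use a in auto)
  then show ?thesis
    using False by (simp add: extend_const_def)
qed

lemma extend_const_ideal: "a \<in> A \<Longrightarrow> extend_const A L a = L a"
  by (simp add: extend_const_def)

lemma Gam_extend_const:
  assumes "a \<in> A" "b \<in> A"
  shows "Gam (extend_const A L) (\<lambda>y. a y + c) (\<lambda>y. b y + d) = Gam L a b"
proof -
  have "(\<lambda>y. (a y + c) * (b y + d)) = (\<lambda>y. (a y * b y + (c * b y + d * a y)) + c * d)"
    by (simp add: fun_eq_iff algebra_simps)
  then have "extend_const A L (\<lambda>y. (a y + c) * (b y + d)) =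
      (\<lambda>x. L (\<lambda>y. a y * b y) x + (c * L b x + d * L a x))"
    using assms by (simp add: extend_const_add add_mem mult_mem scale_mem L_add L_scale)
  then show ?thesis
    using assms by (simp add: Gam_def fun_eq_iff extend_const_add) (simp add: algebra_simps)
qed

lemma Gam_extend_const_ideal:
  "a \<in> A \<Longrightarrow> b \<in> A \<Longrightarrow> Gam (extend_const A L) a b = Gam L a b"
  using Gam_extend_const[of a b 0 0] by simp

lemma gamma_calculus_extend_const:
  "gamma_calculus A (adjoin_const A) (extend_const A L)"
proof
  fix f g h :: "'a \<Rightarrow> real" and c :: real and x
  have I: "(\<lambda>x. a x + c) \<in> adjoin_const A" if "a \<in> A" for a c
    using that by (auto simp: adjoin_const_def)
  show "A \<subseteq> adjoin_const A"
    using I[of _ 0] by auto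
  show "(\<lambda>x. c) \<in> adjoin_const A"
    using I[OF zero_mem] by simp
  show "extend_const A L (\<lambda>x. c) = (\<lambda>x. 0)"
    using extend_const_add[OF zero_mem, of c] L_scale[OF zero_mem, of 0] by simp
  show "(\<lambda>x. f x + g x) \<in> A" if "f \<in> A" "g \<in> A"
    using that by (rule add_mem)
  assume "f \<in> adjoin_const A"
  then obtain a c where f: "a \<in> A" "f = (\<lambda>x. a x + c)"
    by (auto simp: adjoin_const_def)
  show "extend_const A L f \<in> A"
    using f by (simp add: extend_const_add L_mem)
  show "0 \<le> Gam (extend_const A L) f f x"
    using f by (simp add: Gam_extend_const Gam_nonneg)
  show "\<exists>a\<in>A. \<exists>c. f = (\<lambda>x. a x + c)"
    using f by blast
  show "extend_const A L (\<lambda>x. d * f x) = (\<lambda>x. d * extend_const A L f x)" for d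
    using f extend_const_add[OF scale_mem[OF f(1)], of d "d * c"]
    by (simp add: extend_const_add L_scale distrib_left)
  show "(\<lambda>x. f x * g x) \<in> A" if "g \<in> A"
    using add_mem[OF mult_mem[OF f(1) that] scale_mem[OF that, of c]] f(2)
    by (simp add: algebra_simps)
  assume "g \<in> adjoin_const A"
  then obtain b d where g: "b \<in> A" "g = (\<lambda>x. b x + d)"
    by (auto simp: adjoin_const_def)
  have ab: "(\<lambda>x. a x * b x + (c * b x + d * a x)) \<in> A"
    using f(1) g(1) by (intro add_mem mult_mem scale_mem)
  have fg: "(\<lambda>x. f x * g x) = (\<lambda>x. (a x * b x + (c * b x + d * a x)) + c * d)"
    by (simp add: f g fun_eq_iff algebra_simps)
  show "(\<lambda>x. f x * g x) \<in> adjoin_const A"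
    unfolding fg by (rule I[OF ab])
  have sum: "(\<lambda>x. f x + g x) = (\<lambda>x. (a x + b x) + (c + d))"
    by (simp add: f g fun_eq_iff algebra_simps)
  show "(\<lambda>x. f x + g x) \<in> adjoin_const A"
    unfolding sum by (rule I[OF add_mem[OF f(1) g(1)]])
  show "extend_const A L (\<lambda>x. f x + g x) = (\<lambda>x. extend_const A L f x + extend_const A L g x)"
    unfolding sum using f g by (simp add: extend_const_add[OF add_mem[OF f(1) g(1)]] extend_const_add L_add)
  assume "h \<in> adjoin_const A"
  then obtain k e where h: "k \<in> A" "h = (\<lambda>x. k x + e)"
    by (auto simp: adjoin_const_def)
  have sc: "Gam L (\<lambda>y. t * l y) k x = t * Gam L l k x" if "l \<in> A" for t l
    using that h(1) L_scale[OF mult_mem[OF that h(1)], of t]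
    by (simp add: Gam_def L_scale mult.assoc) (simp add: field_simps)
  show "Gam (extend_const A L) (\<lambda>y. f y * g y) h x
      = f x * Gam (extend_const A L) g h x + g x * Gam (extend_const A L) f h x"
    unfolding fg h(2) Gam_extend_const[OF ab h(1)]
    using f g h by (simp add: Gam_extend_const Gam_add Gam_mult sc add_mem mult_mem scale_mem)
      (simp add: algebra_simps)
qed

end

lemma weighted_square_le:
  fixes a b N M :: real
  assumes "0 < N" "N < M"
  shows "1 / M * (a + b)\<^sup>2 \<le> 1 / N * a\<^sup>2 + 1 / (M - N) * b\<^sup>2"
proof -
  have "1 / N * a\<^sup>2 + 1 / (M - N) * b\<^sup>2 - 1 / M * (a + b)\<^sup>2 =
      ((M - N) * a - N * b)\<^sup>2 / (N * (M - N) * M)"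
    using assms by (simp add: divide_simps) (simp add: algebra_simps power2_eq_square)
  moreover have "0 \<le> \<dots>"
    using assms by simp
  ultimately show ?thesis by simp
qed

section \<open>The transformed Ricci tensor\<close>

theorem theorem6p1:
  fixes A :: "('a \<Rightarrow> real) set"
    and L Lx L' :: "('a \<Rightarrow> real) \<Rightarrow> 'a \<Rightarrow> real"
    and f u :: "'a \<Rightarrow> real"
    and g h :: "nat \<Rightarrow> 'a \<Rightarrow> real"
    and r :: nat and N :: real and N' :: ereal and x :: 'a
  assumes "diffusion_operator A L"
    and "Lx = extend_const A L"
    and "f \<in> adjoin_const A"
    and "\<And>i. i \<in> {1..r} \<Longrightarrow> g i \<in> adjoin_const A"
    and "\<And>i. i \<in> {1..r} \<Longrightarrow> h i \<in> adjoin_const A"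
    and "\<And>v y. v \<in> A \<Longrightarrow>
           L' v y = (f y)\<^sup>2 * L v y + f y * (\<Sum>i=1..r. g i y * Gam Lx (h i) v y)"
    and "1 \<le> N"
    and "ereal N < N' \<or>
         (N' = ereal N \<and> r = 1 \<and> g 1 = (\<lambda>y. - (N - 2)) \<and> h 1 = f)"
    and "u \<in> A"
  shows "Ric A L' N' u x \<ge>
           ereal ((f x) ^ 4) * Ric A L (ereal N) u x +
           ereal (
             - (if N' = ereal N then 0
                else real_of_ereal (1 / (N' - ereal N)) *
                     ((N - 2) / 2 * Gam Lx (\<lambda>y. (f y)\<^sup>2) u x
                      + (\<Sum>i=1..r. f x * g i x * Gam Lx (h i) u x))\<^sup>2)
             + 1 / 2 * ((f x)\<^sup>2 * Lx (\<lambda>y. (f y)\<^sup>2) x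
                         - Gam Lx (\<lambda>y. (f y)\<^sup>2) (\<lambda>y. (f y)\<^sup>2) x) * Gam L u u x
             - (N - 2) / 4 * (Gam Lx (\<lambda>y. (f y)\<^sup>2) u x)\<^sup>2
             - (\<Sum>i=1..r. (f x) ^ 3 * g i x * Hess Lx (h i) u u x)
             + 1 / 2 * (\<Sum>i=1..r. f x * g i x * Gam Lx (h i) (\<lambda>y. (f y)\<^sup>2) x) * Gam L u u x
             - (\<Sum>i=1..r. (f x)\<^sup>2 * Gam Lx (\<lambda>y. f y * g i y) u x * Gam Lx (h i) u x))"
proof -
  interpret D: diffusion_operator A L by fact
  interpret G: gamma_calculus A "adjoin_const A" Lx
    unfolding assms(2) by (rule D.gamma_calculus_extend_const)
  have Lx: "Lx v = L v" if "v \<in> A" for v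
    using that by (simp add: assms(2) D.extend_const_ideal)
  have Gam: "Gam Lx v w = Gam L v w" if "v \<in> A" "w \<in> A" for v w
    using that by (simp add: assms(2) D.Gam_extend_const_ideal)
  have Gam2: "Gam2 Lx v v = Gam2 L v v" if "v \<in> A" for v
    using that G.Gam_ideal[OF G.ideal_mem[OF that] that]
    by (simp add: Gam2_def fun_eq_iff Gam Lx D.L_mem)
  have L': "L' v y = (f y)\<^sup>2 * Lx v y + f y * (\<Sum>i=1..r. g i y * Gam Lx (h i) v y)"
    if "v \<in> A" for v y
    using assms(6)[OF that] that by (simp add: Lx)
  note [simp] = \<open>u \<in> A\<close>
  note tc = \<open>f \<in> adjoin_const A\<close> finite_atLeastAtMost[of 1 r] assms(4,5) L'
  define b where "b = (N - 2) / 2 * Gam Lx (\<lambda>y. (f y)\<^sup>2) u x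
      + (\<Sum>i=1..r. f x * g i x * Gam Lx (h i) u x)"
  define \<beta> where "\<beta> = (if N' = ereal N then 0 else real_of_ereal (1 / (N' - ereal N)))"
  have square_le: "real_of_ereal (1 / N') * (a + b)\<^sup>2 \<le> 1 / N * a\<^sup>2 + \<beta> * b\<^sup>2" for a
  proof (cases "N' = ereal N")
    case True
    then have "b = 0"
      using assms(8) by (simp add: b_def G.Gam_power2[OF assms(3) G.ideal_mem])
        (auto simp: algebra_simps)
    then show ?thesis
      using True \<open>1 \<le> N\<close> by (simp add: \<beta>_def one_ereal_def)
  next
    case False
    then have "ereal N < N'"
      using assms(8) by auto
    then show ?thesis
      using \<open>1 \<le> N\<close> weighted_square_le[of N _ a b]
      by (cases N') (auto simp: \<beta>_def one_ereal_def)
  qed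
  have \<beta>: "(if N' = ereal N then 0 else real_of_ereal (1 / (N' - ereal N)) * b\<^sup>2) = \<beta> * b\<^sup>2"
    by (simp add: \<beta>_def)
  show ?thesis
    unfolding Ric_def[of A L' N'] b_def[symmetric] \<beta>
  proof (rule INF_greatest)
    fix v assume "v \<in> {v \<in> A. Gam L' (\<lambda>y. v y - u y) (\<lambda>y. v y - u y) x = 0}"
    then have v: "v \<in> A" and vu': "Gam L' (\<lambda>y. v y - u y) (\<lambda>y. v y - u y) x = 0"
      by auto
    have vu_mem: "(\<lambda>y. v y - u y) \<in> A"
      using v by (intro D.diff_mem) simp_all
    show "ereal (f x ^ 4) * Ric A L (ereal N) u x + ereal (- (\<beta> * b\<^sup>2)
             + 1 / 2 * ((f x)\<^sup>2 * Lx (\<lambda>y. (f y)\<^sup>2) x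
                         - Gam Lx (\<lambda>y. (f y)\<^sup>2) (\<lambda>y. (f y)\<^sup>2) x) * Gam L u u x
             - (N - 2) / 4 * (Gam Lx (\<lambda>y. (f y)\<^sup>2) u x)\<^sup>2
             - (\<Sum>i=1..r. (f x) ^ 3 * g i x * Hess Lx (h i) u u x)
             + 1 / 2 * (\<Sum>i=1..r. f x * g i x * Gam Lx (h i) (\<lambda>y. (f y)\<^sup>2) x) * Gam L u u x
             - (\<Sum>i=1..r. (f x)\<^sup>2 * Gam Lx (\<lambda>y. f y * g i y) u x * Gam Lx (h i) u x))
       \<le> ereal (Gam2 L' v v x - real_of_ereal (1 / N') * (L' v x)\<^sup>2)"
      (is "_ * ?R + ereal ?E \<le> ereal ?S")
    proof (cases "f x = 0")
      case True
      have "b = 0" "?E = 0"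
        using True assms(3) by (simp_all add: b_def G.Gam_power2 G.mem G.ideal_mem)
      moreover have "?S = 0"
        using True v G.Gam2_L'[OF tc v, of x] by (simp add: L' G.Gam_power2 G.ideal_mem)
      ultimately show ?thesis
        using True by (simp add: zero_ereal_def[symmetric])
    next
      case False
      have vu: "Gam Lx (\<lambda>y. v y - u y) (\<lambda>y. v y - u y) x = 0"
        using vu' False G.Gam_L'[OF tc vu_mem vu_mem] by simp
      have Ric_le: "?R \<le> ereal (Gam2 Lx w w x - 1 / N * (Lx w x)\<^sup>2)"
        if "w \<in> A" "Gam Lx (\<lambda>y. w y - u y) (\<lambda>y. w y - u y) x = 0" for w
        using that \<open>1 \<le> N\<close> D.diff_mem[of w u] unfolding Ric_def
        by (intro INF_lower2[of w]) (simp_all add: Gam Gam2 Lx one_ereal_def)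
      \<comment> \<open>if \<open>?R = -\<infinity>\<close>, the factor \<open>(f x) ^ 4 > 0\<close> makes the left-hand side \<open>-\<infinity>\<close>\<close>
      show ?thesis
      proof (cases ?R)
        case (real R)
        have "(f x) ^ 4 * R + ?E \<le> ?S"
          using G.time_change_bound[OF tc \<open>u \<in> A\<close> \<open>1 \<le> N\<close> False _ v vu b_def square_le, of R]
            Ric_le by (simp add: real Gam)
        then show ?thesis
          by (simp add: real)
      next
        case PInf
        then show ?thesis
          using Ric_le[OF v vu] by simp
      next
        case MInf
        then show ?thesis
          using False by (simp add: zero_less_power_eq)
      qed
    qed
  qed
qed

end
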